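(* Let $n,m\ge 1$ and let $\Sigma=\begin{bmatrix}\Sigma_x & \Sigma_{xy}\\ \Sigma_{xy}^T & \Sigma_y\end{bmatrix}\succeq 0$ be a real symmetric positive semidefinite matrix, with $\Sigma_x\in\mathbb{R}^{n\times n}$, $\Sigma_y\in\mathbb{R}^{m\times m}$, $\Sigma_{xy}\in\mathbb{R}^{n\times m}$. Let $I\subseteq\{1,\dots,n\}$ and $J\subseteq\{1,\dots,m\}$ be nonempty, and let $a^{I,J}\in\mathbb{R}^{|I|}$ and $b^{I,J}\in\mathbb{R}^{|J|}$ be an optimal solution (a maximizing pair) of the problem defining $\rho\left(\Sigma_x^{I,I},\Sigma_y^{J,J},\Sigma_{xy}^{I,J}\right)$, normalized so that $[a^{I,J}]^T\Sigma_x^{I,I}a^{I,J}=1$ and $[b^{I,J}]^T\Sigma_y^{J,J}b^{I,J}=1$. Let $i\in\{1,\dots,n\}\setminus I$ and $j\in\{1,\dots,m\}\setminus J$. Assume that all the matrix inversions involved are nonsingular, i.e., $\Sigma_x^{I,I}$ and $\Sigma_y^{J,J}$ are invertible and the denominators of $\delta_i^{I,J}$ and $\gamma_j^{I,J}$ below are nonzero (equivalently, $\Sigma_x^{I\cup i,I\cup i}$ and $\Sigma_y^{J\cup j,J\cup j}$ are invertible as well). Then $$\rho^2\left(\Sigma_x^{I\cup i,I\cup i},\Sigma_y^{J,J},\Sigma_{xy}^{I\cup i,J}\right)\ \geq\ \rho^2\left(\Sigma_x^{I,I},\Sigma_y^{J,J},\Sigma_{xy}^{I,J}\right)+\delta_i^{I,J}$$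 and $$\rho^2\left(\Sigma_x^{I,I},\Sigma_y^{J\cup j,J\cup j},\Sigma_{xy}^{I,J\cup j}\right)\ \geq\ \rho^2\left(\Sigma_x^{I,I},\Sigma_y^{J,J},\Sigma_{xy}^{I,J}\right)+\gamma_j^{I,J},$$ where $$\delta_i^{I,J}=\frac{\left([b^{I,J}]^T[\Sigma_{xy}^{I,J}]^T[\Sigma_x^{I,I}]^{-1}\Sigma_x^{I,i}-[b^{I,J}]^T[\Sigma_{xy}^{i,J}]^T\right)^2}{\Sigma_x^{i,i}-[\Sigma_x^{I,i}]^T[\Sigma_x^{I,I}]^{-1}\Sigma_x^{I,i}},$$ $$\gamma_j^{I,J}=\frac{\left([a^{I,J}]^T\Sigma_{xy}^{I,J}[\Sigma_y^{J,J}]^{-1}\Sigma_y^{J,j}-[a^{I,J}]^T\Sigma_{xy}^{I,j}\right)^2}{\Sigma_y^{j,j}-[\Sigma_y^{J,j}]^T[\Sigma_y^{J,J}]^{-1}\Sigma_y^{J,j}}.$$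
   Context: For index sets $I,J$, $X^{I,J}$ denotes the submatrix of $X$ with rows indexed by $I$ and columns indexed by $J$; a single index $i$ in a superscript stands for $\{i\}$, and $I\cup i$ stands for $I\cup\{i\}$. Thus $\Sigma_x^{I,i}$ is a column vector, $\Sigma_{xy}^{i,J}$ is a row vector and $\Sigma_{xy}^{I,j}$ is a column vector. For the blocks $\Sigma_x\in\mathbb{R}^{p\times p}$, $\Sigma_y\in\mathbb{R}^{q\times q}$, $\Sigma_{xy}\in\mathbb{R}^{p\times q}$ of a positive semidefinite joint covariance matrix, the canonical correlation is $$\rho(\Sigma_x,\Sigma_y,\Sigma_{xy})=\max_{a\in\mathbb{R}^p\setminus\{0\},\ b\in\mathbb{R}^q\setminus\{0\}}\frac{a^T\Sigma_{xy}b}{\sqrt{a^T\Sigma_x a}\,\sqrt{b^T\Sigma_y b}},$$ with the convention $0/0=1$. The objective is invariant to positive scaling of $a$ and $b$, and maximizers are normalized so that $a^T\Sigma_x a=1$ and $b^T\Sigma_y b=1$. $\rho^2(\cdot)$ denotes the square of $\rho(\cdot)$. *)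

theory Defs
  imports
    Complex_Main
    "Jordan_Normal_Form.DL_Submatrix"
    "Jordan_Normal_Form.Gauss_Jordan_Elimination"
begin

definition quad_form :: "real mat \<Rightarrow> real vec \<Rightarrow> real" where
  "quad_form A v = v \<bullet> (A *\<^sub>v v)"

definition psd_mat :: "real mat \<Rightarrow> bool" where
  "psd_mat A \<longleftrightarrow> square_mat A \<and> A\<^sup>T = A \<and>
     (\<forall>v \<in> carrier_vec (dim_row A). quad_form A v \<ge> 0)"

(* Junk value "the None" when A is singular; only used for invertible A. *)
definition minv :: "real mat \<Rightarrow> real mat" where
  "minv A = the (mat_inverse A)"

(* The convention 0/0 = 1 has to be built in, since x / 0 = 0 in HOL. If the joint matrix of the
   blocks is positive semidefinite, a vanishing denominator forces a vanishing numerator. *)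
definition cca_objective ::
    "real mat \<Rightarrow> real mat \<Rightarrow> real mat \<Rightarrow> real vec \<Rightarrow> real vec \<Rightarrow> real" where
  "cca_objective Sx Sy Sxy a b =
    (let num = a \<bullet> (Sxy *\<^sub>v b);
         den = sqrt (quad_form Sx a) * sqrt (quad_form Sy b)
     in if num = 0 \<and> den = 0 then 1 else num / den)"

definition nonzero_vecs :: "nat \<Rightarrow> real vec set" where
  "nonzero_vecs k = carrier_vec k - {0\<^sub>v k}"

(* GREATEST is the maximum of the set of objective values, which is infinite in general, so that
   Max is not applicable. For blocks of a positive semidefinite matrix the maximum exists. *)
definition canonical_corr :: "real mat \<Rightarrow> real mat \<Rightarrow> real mat \<Rightarrow> real" where
  "canonical_corr Sx Sy Sxy =
    (GREATEST r. \<exists>a \<in> nonzero_vecs (dim_row Sx). \<exists>b \<in> nonzero_vecs (dim_row Sy).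
       r = cca_objective Sx Sy Sxy a b)"

definition cca_maximizer ::
    "real mat \<Rightarrow> real mat \<Rightarrow> real mat \<Rightarrow> real vec \<Rightarrow> real vec \<Rightarrow> bool" where
  "cca_maximizer Sx Sy Sxy a b \<longleftrightarrow>
     a \<in> nonzero_vecs (dim_row Sx) \<and> b \<in> nonzero_vecs (dim_row Sy) \<and>
     (\<forall>a' \<in> nonzero_vecs (dim_row Sx). \<forall>b' \<in> nonzero_vecs (dim_row Sy).
        cca_objective Sx Sy Sxy a' b' \<le> cca_objective Sx Sy Sxy a b)"

definition subcol :: "real mat \<Rightarrow> nat set \<Rightarrow> nat \<Rightarrow> real vec" where
  "subcol A I j = col (submatrix A I {j}) 0"

definition subrow :: "real mat \<Rightarrow> nat \<Rightarrow> nat set \<Rightarrow> real vec" where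
  "subrow A i J = row (submatrix A {i} J) 0"

(* Common shape of the denominators of delta and gamma: S^{k,k} - (S^{K,k})^T (S^{K,K})^{-1} S^{K,k} *)
definition schur_den :: "real mat \<Rightarrow> nat set \<Rightarrow> nat \<Rightarrow> real" where
  "schur_den S K k =
     S $$ (k, k) - subcol S K k \<bullet> (minv (submatrix S K K) *\<^sub>v subcol S K k)"

definition delta ::
    "real mat \<Rightarrow> real mat \<Rightarrow> nat set \<Rightarrow> nat set \<Rightarrow> real vec \<Rightarrow> nat \<Rightarrow> real" where
  "delta Sx Sxy I J b i =
     (b \<bullet> ((submatrix Sxy I J)\<^sup>T *\<^sub>v (minv (submatrix Sx I I) *\<^sub>v subcol Sx I i))
        - b \<bullet> subrow Sxy i J)\<^sup>2
     / schur_den Sx I i"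

definition gamma ::
    "real mat \<Rightarrow> real mat \<Rightarrow> nat set \<Rightarrow> nat set \<Rightarrow> real vec \<Rightarrow> nat \<Rightarrow> real" where
  "gamma Sy Sxy I J a j =
     (a \<bullet> (submatrix Sxy I J *\<^sub>v (minv (submatrix Sy J J) *\<^sub>v subcol Sy J j))
        - a \<bullet> subcol Sxy I j)\<^sup>2
     / schur_den Sy J j"

end

(* Write c for the vector Sxy^{I+i,J} b, with restriction c_I to I. For fixed b the best a' on
   I+i is (Sx^{I+i,I+i})^{-1} c, which attains the squared correlation
   c^T (Sx^{I+i,I+i})^{-1} c. By block elimination with w = (Sx^{I,I})^{-1} Sx^{I,i} this number is
   c_I^T (Sx^{I,I})^{-1} c_I + delta, and by Cauchy-Schwarz the first summand is at least
   (a^T c_I)^2, the squared correlation on I. The second inequality is the first one for the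
   transposed problem. The new canonical correlation dominates the value at a' because the
   enlarged block is positive definite (its Schur complement is nonzero), so that the objective is
   continuous on a product of spheres and its maximum exists. *)

theory Submission
  imports Defs "HOL-Analysis.Function_Topology"
begin

section \<open>Vectors and submatrices over index sets\<close>

text \<open>A vector over \<open>K\<close> is the restriction of a function on all indices, so that
  entries keep their original indices and products with submatrices become sums over
  \<open>K\<close>.\<close>

definition restr :: "nat set \<Rightarrow> (nat \<Rightarrow> real) \<Rightarrow> real vec" where
  "restr K f = vec (card K) (\<lambda>k. f (pick K k))"

lemma dim_restr [simp]: "dim_vec (restr K f) = card K"
  by (simp add: restr_def)

lemma restr_carrier [simp]: "restr K f \<in> carrier_vec (card K)"
  by (simp add: restr_def)

lemma pick_card_in: "k < card K \<Longrightarrow> pick K k \<in> K"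
  by (rule pick_in_set) simp

lemma restr_cong: "(\<And>k. k \<in> K \<Longrightarrow> f k = g k) \<Longrightarrow> restr K f = restr K g"
  by (auto simp: restr_def pick_card_in)

lemma bij_betw_pick: "finite K \<Longrightarrow> bij_betw (pick K) {..<card K} K"
proof -
  assume fin: "finite K"
  have "inj_on (pick K) {..<card K}"
    by (metis inj_onI lessThan_iff linorder_neqE_nat order_less_irrefl pick_mono)
  moreover have "pick K ` {..<card K} \<subseteq> K"
    by (auto simp: pick_card_in)
  ultimately show ?thesis
    using fin by (simp add: bij_betw_def card_image card_subset_eq)
qed

lemma sum_pick: "finite K \<Longrightarrow> (\<Sum>k<card K. h (pick K k)) = sum h K"
  by (rule sum.reindex_bij_betw) (rule bij_betw_pick)

lemma restr_eq_iff:
  assumes "finite K"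
  shows "restr K f = restr K g \<longleftrightarrow> (\<forall>k\<in>K. f k = g k)"
proof
  assume eq: "restr K f = restr K g"
  show "\<forall>k\<in>K. f k = g k"
  proof
    fix k assume "k \<in> K"
    then obtain l where l: "l < card K" "k = pick K l"
      using bij_betw_pick[OF assms] by (auto simp: bij_betw_def)
    show "f k = g k"
      using arg_cong[OF eq, of "\<lambda>v. v $ l"] l by (simp add: restr_def)
  qed
qed (rule restr_cong, simp)

lemma restr_surj:
  assumes "v \<in> carrier_vec (card K)"
  obtains f where "v = restr K f"
proof
  \<comment> \<open>The number of elements of \<open>K\<close> below \<open>k\<close> is the
    position of \<open>k\<close> in the enumeration \<open>pick K\<close>.\<close>
  show "v = restr K (\<lambda>k. v $ card {a \<in> K. a < k})"
    using assms by (intro eq_vecI) (auto simp: restr_def card_pick)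
qed

lemma scalar_prod_restr:
  "finite K \<Longrightarrow> restr K f \<bullet> restr K g = (\<Sum>k\<in>K. f k * g k)"
  using sum_pick[of K "\<lambda>k. f k * g k"]
  by (simp add: scalar_prod_def restr_def atLeast0LessThan)

lemma Collect_less_subset: "I \<subseteq> {..<n::nat} \<Longrightarrow> {i. i < n \<and> i \<in> I} = I"
  by auto

lemma submatrix_carrier:
  assumes "A \<in> carrier_mat n m" "I \<subseteq> {..<n}" "J \<subseteq> {..<m}"
  shows "submatrix A I J \<in> carrier_mat (card I) (card J)"
  using assms by (intro carrier_matI) (simp_all add: dim_submatrix Collect_less_subset)

lemma submatrix_entry:
  assumes "A \<in> carrier_mat n m" "I \<subseteq> {..<n}" "J \<subseteq> {..<m}" "k < card I" "l < card J"
  shows "submatrix A I J $$ (k, l) = A $$ (pick I k, pick J l)"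
  using assms by (intro submatrix_index) (simp_all add: Collect_less_subset)

lemma submatrix_mult_restr:
  assumes "A \<in> carrier_mat n m" "I \<subseteq> {..<n}" "J \<subseteq> {..<m}"
  shows "submatrix A I J *\<^sub>v restr J g = restr I (\<lambda>i. \<Sum>j\<in>J. A $$ (i, j) * g j)"
proof (rule eq_vecI)
  note car = submatrix_carrier[OF assms]
  fix k assume "k < dim_vec (restr I (\<lambda>i. \<Sum>j\<in>J. A $$ (i, j) * g j))"
  then have k: "k < card I" by simp
  have "(submatrix A I J *\<^sub>v restr J g) $ k
      = (\<Sum>l<card J. A $$ (pick I k, pick J l) * g (pick J l))"
    using car k by (simp add: scalar_prod_def restr_def atLeast0LessThan submatrix_entry[OF assms])
  also have "\<dots> = (\<Sum>j\<in>J. A $$ (pick I k, j) * g j)"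
    using sum_pick[of J "\<lambda>j. A $$ (pick I k, j) * g j"] assms(3) finite_subset by blast
  finally show "(submatrix A I J *\<^sub>v restr J g) $ k
      = restr I (\<lambda>i. \<Sum>j\<in>J. A $$ (i, j) * g j) $ k"
    using k by (simp add: restr_def)
qed (use submatrix_carrier[OF assms] in simp)

lemma submatrix_transpose:
  assumes "A \<in> carrier_mat n m" "I \<subseteq> {..<n}" "J \<subseteq> {..<m}"
  shows "submatrix A\<^sup>T J I = (submatrix A I J)\<^sup>T"
proof (rule eq_matI)
  have pick: "pick J k < m" "pick I l < n" if "k < card J" "l < card I" for k l
    using assms pick_card_in[of k J] pick_card_in[of l I] that by auto
  show "submatrix A\<^sup>T J I $$ (k, l) = (submatrix A I J)\<^sup>T $$ (k, l)"
    if "k < dim_row (submatrix A I J)\<^sup>T" "l < dim_col (submatrix A I J)\<^sup>T" for k l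
    using that assms submatrix_carrier[OF assms] pick
    by (simp add: submatrix_entry[of _ m n] submatrix_entry[of _ n m])
qed (use assms submatrix_carrier[OF assms] submatrix_carrier[of "A\<^sup>T" m n J I] in auto)

lemma pick_singleton: "pick {i} 0 = i"
  by (auto intro: Least_equality)

lemma subcol_restr:
  assumes "A \<in> carrier_mat n m" "I \<subseteq> {..<n}" "j < m"
  shows "subcol A I j = restr I (\<lambda>i. A $$ (i, j))"
  using assms submatrix_carrier[of A n m I "{j}"]
  by (intro eq_vecI)
    (auto simp: subcol_def restr_def submatrix_entry[of _ n m] pick_singleton simp del: pick.simps)

lemma subrow_restr:
  assumes "A \<in> carrier_mat n m" "i < n" "J \<subseteq> {..<m}"
  shows "subrow A i J = restr J (\<lambda>j. A $$ (i, j))"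
  using assms submatrix_carrier[of A n m "{i}" J]
  by (intro eq_vecI)
    (auto simp: subrow_def restr_def submatrix_entry[of _ n m] pick_singleton simp del: pick.simps)

text \<open>\<open>mat_inverse\<close> returns \<open>None\<close> only for matrices that are not
  units of the matrix ring, so an inverse in the sense of \<open>invertible_mat\<close> excludes the
  junk value.\<close>

lemma minv_inverse:
  assumes A: "A \<in> carrier_mat k k" and inv: "invertible_mat A"
  shows "minv A \<in> carrier_mat k k" "A * minv A = 1\<^sub>m k" "minv A * A = 1\<^sub>m k"
proof -
  obtain B where AB: "A * B = 1\<^sub>m k" and BA: "B * A = 1\<^sub>m (dim_row B)"
    using inv A by (auto simp: invertible_mat_def inverts_mat_def)
  \<comment> \<open>The notion of inverse leaves the dimensions of \<open>B\<close> open; the column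
    counts of the two products fix them.\<close>
  have "B \<in> carrier_mat k k"
    using arg_cong[OF AB, of dim_col] arg_cong[OF BA, of dim_col] A by auto
  then have "A \<in> Units (ring_mat TYPE(real) k ())"
    using A AB BA by (auto simp: Units_def ring_mat_simps)
  with mat_inverse(1)[OF A, where b = "()"] obtain C where "mat_inverse A = Some C"
    by fastforce
  with mat_inverse(2)[OF A this]
  show "minv A \<in> carrier_mat k k" "A * minv A = 1\<^sub>m k" "minv A * A = 1\<^sub>m k"
    by (auto simp: minv_def)
qed

text \<open>Turns an application of \<open>minv\<close> into a linear system indexed by
  \<open>K\<close>; the main computation works with the equations for \<open>h\<close>.\<close>

lemma minv_restr:
  assumes A: "A \<in> carrier_mat n n" and K: "K \<subseteq> {..<n}"
    and inv: "invertible_mat (submatrix A K K)"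
  obtains h where "minv (submatrix A K K) *\<^sub>v restr K g = restr K h"
    and "\<And>k. k \<in> K \<Longrightarrow> (\<Sum>l\<in>K. A $$ (k, l) * h l) = g k"
proof -
  let ?S = "submatrix A K K"
  note S = submatrix_carrier[OF A K K]
  note M = minv_inverse[OF S inv]
  obtain h where h: "minv ?S *\<^sub>v restr K g = restr K h"
    using restr_surj[of "minv ?S *\<^sub>v restr K g" K] M(1) by (metis mult_mat_vec_carrier restr_carrier)
  have "?S *\<^sub>v restr K h = restr K g"
    unfolding h[symmetric] using S M by (simp flip: assoc_mult_mat_vec)
  then have "\<forall>k\<in>K. (\<Sum>l\<in>K. A $$ (k, l) * h l) = g k"
    using K finite_subset[OF K] by (simp add: submatrix_mult_restr[OF A K K] restr_eq_iff)
  with h that show thesis by blast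
qed

section \<open>Quadratic forms and definiteness on index sets\<close>

text \<open>The index set is a parameter separate from the matrix, which allows comparing the forms
  on \<open>K\<close> and on a larger set.\<close>

definition qform :: "nat set \<Rightarrow> real mat \<Rightarrow> (nat \<Rightarrow> real) \<Rightarrow> real" where
  "qform K A f = (\<Sum>k\<in>K. f k * (\<Sum>l\<in>K. A $$ (k, l) * f l))"

lemma quad_form_restr:
  assumes "A \<in> carrier_mat n n" "K \<subseteq> {..<n}"
  shows "quad_form (submatrix A K K) (restr K f) = qform K A f"
  using assms finite_subset[OF assms(2)]
  by (simp add: quad_form_def submatrix_mult_restr[OF assms(1,2,2)] scalar_prod_restr qform_def)

text \<open>Symmetry makes the two mixed terms of the bilinear expansion equal.\<close>

lemma qform_add:
  assumes "\<And>k l. k \<in> K \<Longrightarrow> l \<in> K \<Longrightarrow> A $$ (k, l) = A $$ (l, k)"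
  shows "qform K A (\<lambda>k. f k + c * g k)
    = qform K A f + 2 * c * (\<Sum>k\<in>K. f k * (\<Sum>l\<in>K. A $$ (k, l) * g l)) + c\<^sup>2 * qform K A g"
proof -
  have sym: "(\<Sum>k\<in>K. g k * (\<Sum>l\<in>K. A $$ (k, l) * f l)) = (\<Sum>k\<in>K. f k * (\<Sum>l\<in>K. A $$ (k, l) * g l))"
    unfolding sum_distrib_left
    by (subst sum.swap, intro sum.cong refl) (simp add: assms mult_ac)
  have "qform K A (\<lambda>k. f k + c * g k)
     = (\<Sum>k\<in>K. f k * (\<Sum>l\<in>K. A $$ (k, l) * f l) + c * (f k * (\<Sum>l\<in>K. A $$ (k, l) * g l))
         + c * (g k * (\<Sum>l\<in>K. A $$ (k, l) * f l)) + c\<^sup>2 * (g k * (\<Sum>l\<in>K. A $$ (k, l) * g l)))"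
    unfolding qform_def
    by (intro sum.cong refl)
      (simp add: algebra_simps sum.distrib power2_eq_square flip: sum_distrib_left)
  then show ?thesis
    by (simp add: sum.distrib sym qform_def flip: sum_distrib_left)
qed

text \<open>Symmetry on \<open>K\<close> is included because nonnegativity of a real form does not
  imply it, and the expansion in \<open>qform_add\<close> depends on it.\<close>

definition psd_on :: "nat set \<Rightarrow> real mat \<Rightarrow> bool" where
  "psd_on K A \<longleftrightarrow> (\<forall>k\<in>K. \<forall>l\<in>K. A $$ (k, l) = A $$ (l, k)) \<and> (\<forall>f. qform K A f \<ge> 0)"

lemma qform_mono_neutral:
  assumes "finite L" "K \<subseteq> L" "\<And>k. k \<in> L - K \<Longrightarrow> f k = 0"
  shows "qform L A f = qform K A f"
proof -
  have "(\<Sum>l\<in>L. A $$ (k, l) * f l) = (\<Sum>l\<in>K. A $$ (k, l) * f l)" for k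
    using assms by (intro sum.mono_neutral_right) auto
  then show ?thesis
    unfolding qform_def using assms by (intro sum.mono_neutral_cong_right) auto
qed

lemma qform_cong: "(\<And>k. k \<in> K \<Longrightarrow> f k = g k) \<Longrightarrow> qform K A f = qform K A g"
  by (simp add: qform_def)

text \<open>Extending a test function by zero reduces the form on \<open>L\<close> to the form on
  \<open>K\<close>.\<close>

lemma psd_on_subset:
  assumes "psd_on L A" "finite L" "K \<subseteq> L"
  shows "psd_on K A"
  unfolding psd_on_def
proof (intro conjI allI)
  fix f :: "nat \<Rightarrow> real"
  let ?g = "\<lambda>k. if k \<in> K then f k else 0"
  have "0 \<le> qform L A ?g"
    using assms by (simp add: psd_on_def)
  also have "\<dots> = qform K A ?g"
    using assms by (intro qform_mono_neutral) auto
  also have "\<dots> = qform K A f"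
    by (rule qform_cong) simp
  finally show "0 \<le> qform K A f" .
qed (use assms in \<open>auto simp: psd_on_def\<close>)

lemma quad_form_vec:
  "A \<in> carrier_mat n n \<Longrightarrow> quad_form A (vec n f) = qform {..<n} A f"
  by (simp add: quad_form_def qform_def scalar_prod_def atLeast0LessThan)

lemma psd_mat_psd_on:
  assumes "psd_mat A" "A \<in> carrier_mat n n"
  shows "psd_on {..<n} A"
  unfolding psd_on_def
proof (intro conjI ballI allI)
  fix k l assume "k \<in> {..<n}" "l \<in> {..<n}"
  then show "A $$ (k, l) = A $$ (l, k)"
    using assms index_transpose_mat(1)[of k A l] by (auto simp: psd_mat_def)
next
  fix f
  show "0 \<le> qform {..<n} A f"
    using assms by (auto simp: psd_mat_def simp flip: quad_form_vec)
qed

text \<open>On the line through \<open>A f\<close> in direction \<open>f\<close> the form is affine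
  in the parameter, because the quadratic term vanishes. It stays nonnegative, so its slope, twice
  the squared norm of \<open>A f\<close>, must be zero.\<close>

lemma psd_on_zero_imp_kernel:
  assumes psd: "psd_on K A" and fin: "finite K" and zero: "qform K A f = 0" and k: "k \<in> K"
  shows "(\<Sum>l\<in>K. A $$ (k, l) * f l) = 0"
proof -
  let ?h = "\<lambda>k. \<Sum>l\<in>K. A $$ (k, l) * f l"
  let ?N = "\<Sum>k\<in>K. (?h k)\<^sup>2" and ?M = "qform K A ?h"
  have M: "?M \<ge> 0" using psd by (simp add: psd_on_def)
  have pos: "?M + 2 * c * ?N \<ge> 0" for c
  proof -
    have "0 \<le> qform K A (\<lambda>k. ?h k + c * f k)"
      using psd by (simp add: psd_on_def)
    also have "\<dots> = ?M + 2 * c * ?N"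
      using psd by (subst qform_add) (auto simp: psd_on_def zero power2_eq_square)
    finally show ?thesis .
  qed
  have "?N = 0"
  proof (rule ccontr)
    assume "?N \<noteq> 0"
    \<comment> \<open>At this parameter the affine function takes the value -1.\<close>
    then show False using pos[of "- (?M + 1) / (2 * ?N)"] by (simp add: field_simps)
  qed
  then show ?thesis using fin k by (simp add: sum_nonneg_eq_0_iff)
qed

definition pd_on :: "nat set \<Rightarrow> real mat \<Rightarrow> bool" where
  "pd_on K A \<longleftrightarrow> (\<forall>f. (\<exists>k\<in>K. f k \<noteq> 0) \<longrightarrow> qform K A f > 0)"

text \<open>By \<open>psd_on_zero_imp_kernel\<close>, a zero of the form lies in the kernel of the
  submatrix, which is trivial by invertibility.\<close>

lemma pd_on_invertible:
  assumes A: "A \<in> carrier_mat n n" and K: "K \<subseteq> {..<n}" and psd: "psd_on K A"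
    and inv: "invertible_mat (submatrix A K K)"
  shows "pd_on K A"
  unfolding pd_on_def
proof (intro allI impI)
  fix f :: "nat \<Rightarrow> real" assume ex: "\<exists>k\<in>K. f k \<noteq> 0"
  have fin: "finite K" using K finite_subset by blast
  let ?S = "submatrix A K K"
  note S = submatrix_carrier[OF A K K]
  note M = minv_inverse[OF S inv]
  have "qform K A f \<noteq> 0"
  proof
    assume "qform K A f = 0"
    then have "?S *\<^sub>v restr K f = 0\<^sub>v (card K)"
      unfolding submatrix_mult_restr[OF A K K] using psd_on_zero_imp_kernel[OF psd fin]
      by (auto simp: restr_def pick_card_in)
    then have "minv ?S *\<^sub>v (?S *\<^sub>v restr K f) = 0\<^sub>v (card K)"
      using M by auto
    then have "restr K f = 0\<^sub>v (card K)"
      using S M by (simp flip: assoc_mult_mat_vec)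
    also have "\<dots> = restr K (\<lambda>_. 0)"
      by (auto simp: restr_def)
    finally show False
      using ex fin by (auto simp: restr_eq_iff)
  qed
  moreover have "qform K A f \<ge> 0"
    using psd by (simp add: psd_on_def)
  ultimately show "qform K A f > 0" by simp
qed


lemma pd_on_quad_form_pos:
  assumes "A \<in> carrier_mat n n" "K \<subseteq> {..<n}" "pd_on K A"
    and v: "v \<in> nonzero_vecs (card K)"
  shows "quad_form (submatrix A K K) v > 0"
proof -
  obtain f where f: "v = restr K f"
    using restr_surj[of v K] v by (auto simp: nonzero_vecs_def)
  have "\<exists>k\<in>K. f k \<noteq> 0"
  proof (rule ccontr)
    assume "\<not> ?thesis"
    then have "v = 0\<^sub>v (card K)"
      unfolding f by (auto simp: restr_def pick_card_in)
    with v show False by (simp add: nonzero_vecs_def)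
  qed
  then show ?thesis
    using assms by (simp add: f quad_form_restr pd_on_def)
qed

lemma qform_insert:
  assumes "finite K" "i \<notin> K" and sym: "\<And>k. k \<in> K \<Longrightarrow> A $$ (k, i) = A $$ (i, k)"
  shows "qform (insert i K) A f
    = qform K A f + 2 * f i * (\<Sum>k\<in>K. f k * A $$ (k, i)) + (f i)\<^sup>2 * A $$ (i, i)"
proof -
  have "(\<Sum>k\<in>K. A $$ (i, k) * f k) = (\<Sum>k\<in>K. f k * A $$ (k, i))"
    by (intro sum.cong) (simp_all add: sym)
  then show ?thesis
    using assms
    by (simp add: qform_def algebra_simps sum.distrib power2_eq_square sum_distrib_left)
qed

text \<open>Completing the square with respect to the coordinate \<open>i\<close>: \<open>w\<close> stands for
  \<open>A\<^sup>K\<^sup>K\<close> inverse applied to the column \<open>A\<^sup>K\<^sup>i\<close>.\<close>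

lemma pd_on_insert:
  assumes psd: "psd_on (insert i K) A" and fin: "finite K" and i: "i \<notin> K" and pd: "pd_on K A"
    and w: "\<And>k. k \<in> K \<Longrightarrow> (\<Sum>l\<in>K. A $$ (k, l) * w l) = A $$ (k, i)"
    and s: "A $$ (i, i) - (\<Sum>k\<in>K. A $$ (k, i) * w k) \<noteq> 0" (is "?s \<noteq> 0")
  shows "pd_on (insert i K) A"
proof -
  have sym: "A $$ (k, l) = A $$ (l, k)" if "k \<in> insert i K" "l \<in> insert i K" for k l
    using psd that unfolding psd_on_def by blast
  have square: "qform (insert i K) A f = qform K A (\<lambda>k. f k + f i * w k) + (f i)\<^sup>2 * ?s" for f
  proof -
    have "qform K A (\<lambda>k. f k + f i * w k)
       = qform K A f + 2 * f i * (\<Sum>k\<in>K. f k * A $$ (k, i)) + (f i)\<^sup>2 * (\<Sum>k\<in>K. A $$ (k, i) * w k)"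
    proof -
      have "(\<Sum>k\<in>K. g k * (\<Sum>l\<in>K. A $$ (k, l) * w l)) = (\<Sum>k\<in>K. g k * A $$ (k, i))" for g
        by (intro sum.cong) (simp_all add: w)
      moreover have "(\<Sum>k\<in>K. w k * A $$ (k, i)) = (\<Sum>k\<in>K. A $$ (k, i) * w k)"
        by (simp only: mult.commute)
      ultimately show ?thesis
        using qform_add[of K A f "f i" w, OF sym[OF insertI2 insertI2]]
        by (simp only: qform_def[of K A w])
    qed
    moreover have "qform (insert i K) A f
       = qform K A f + 2 * f i * (\<Sum>k\<in>K. f k * A $$ (k, i)) + (f i)\<^sup>2 * A $$ (i, i)"
      using fin i by (rule qform_insert) (use sym in blast)
    ultimately show ?thesis
      by (simp add: algebra_simps)
  qed
  \<comment> \<open>This function makes the completed square vanish and leaves the Schur complement,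
    which is therefore nonnegative, and positive by hypothesis \<open>s\<close>.\<close>
  have "0 \<le> qform (insert i K) A (\<lambda>k. if k = i then 1 else - w k)"
    using psd by (simp add: psd_on_def)
  also have "\<dots> = qform K A (\<lambda>k. 0) + ?s"
    unfolding square using i by (auto intro!: qform_cong)
  finally have s_pos: "?s > 0"
    using s by (simp add: qform_def)
  show ?thesis
    unfolding pd_on_def
  proof (intro allI impI)
    fix f :: "nat \<Rightarrow> real" assume ex: "\<exists>k\<in>insert i K. f k \<noteq> 0"
    \<comment> \<open>If \<open>f i = 0\<close>, a nonzero entry lies in \<open>K\<close> and the
      form on \<open>K\<close> is positive; otherwise the Schur complement term is positive.\<close>
    show "0 < qform (insert i K) A f"
    proof (cases "f i = 0")
      case True
      then show ?thesis
        using ex pd unfolding square by (auto simp: pd_on_def)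
    next
      case False
      have "psd_on K A"
        using psd by (rule psd_on_subset) (use fin in auto)
      then have "qform K A (\<lambda>k. f k + f i * w k) \<ge> 0"
        unfolding psd_on_def by blast
      moreover have "(f i)\<^sup>2 * ?s > 0"
        using False s_pos by (intro mult_pos_pos) auto
      ultimately show ?thesis
        unfolding square by (rule add_nonneg_pos)
    qed
  qed
qed

section \<open>Existence of a maximizing pair\<close>

text \<open>Numerator and denominator both gain the factor \<open>c * d\<close>; being positive, it
  cancels and does not affect which case of the 0/0 convention applies.\<close>

lemma cca_objective_smult:
  assumes "Sx \<in> carrier_mat p p" "Sy \<in> carrier_mat q q" "Sxy \<in> carrier_mat p q"
    and "a \<in> carrier_vec p" "b \<in> carrier_vec q" and "c > 0" "d > 0"
  shows "cca_objective Sx Sy Sxy (c \<cdot>\<^sub>v a) (d \<cdot>\<^sub>v b) = cca_objective Sx Sy Sxy a b"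
proof -
  have "quad_form S (c \<cdot>\<^sub>v v) = c\<^sup>2 * quad_form S v"
    if "S \<in> carrier_mat k k" "v \<in> carrier_vec k" for S v k and c :: real
    using that by (simp add: quad_form_def mult_mat_vec power2_eq_square)
  then have "sqrt (quad_form Sx (c \<cdot>\<^sub>v a)) = c * sqrt (quad_form Sx a)"
    "sqrt (quad_form Sy (d \<cdot>\<^sub>v b)) = d * sqrt (quad_form Sy b)"
    using assms by (auto simp: real_sqrt_mult)
  moreover have "(c \<cdot>\<^sub>v a) \<bullet> (Sxy *\<^sub>v (d \<cdot>\<^sub>v b)) = (c * d) * (a \<bullet> (Sxy *\<^sub>v b))"
    using assms by (simp add: mult_mat_vec)
  ultimately show ?thesis
    using assms(6,7) by (simp add: cca_objective_def Let_def)
qed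

text \<open>The unit sphere of R^p with vectors extended by zero; leaving the further coordinates
  free would destroy compactness.\<close>

definition fun_sphere :: "nat \<Rightarrow> (nat \<Rightarrow> real) set" where
  "fun_sphere p = {f. (\<forall>k\<ge>p. f k = 0) \<and> (\<Sum>k<p. (f k)\<^sup>2) = 1}"

text \<open>The vectors of \<^typ>\<open>real vec\<close> carry no topology, so compactness is taken from the product
  topology on \<^typ>\<open>nat \<Rightarrow> real\<close>.\<close>

lemma compact_fun_sphere: "compact (fun_sphere p)"
proof -
  \<comment> \<open>By Tychonoff this box is compact; the sphere is its closed part where the
    squares sum to 1.\<close>
  let ?B = "PiE UNIV (\<lambda>k. if k < p then {-1..1} else {0}) :: (nat \<Rightarrow> real) set"
  have "compact ?B"
    using compactin_PiE[of "\<lambda>_. euclidean" UNIV "\<lambda>k. if k < p then {-1..1} else {0::real}"]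
    by (simp add: euclidean_product_topology)
  moreover have "closed {f :: nat \<Rightarrow> real. (\<Sum>k<p. (f k)\<^sup>2) = 1}"
    by (intro closed_Collect_eq continuous_intros continuous_on_product_coordinates)
  moreover have "fun_sphere p = ?B \<inter> {f. (\<Sum>k<p. (f k)\<^sup>2) = 1}"
  proof -
    have "\<bar>f k\<bar> \<le> 1" if "(\<Sum>k<p. (f k)\<^sup>2) = 1" "k < p" for f :: "nat \<Rightarrow> real" and k
    proof -
      have "(f k)\<^sup>2 \<le> (\<Sum>k<p. (f k)\<^sup>2)"
        using that by (intro member_le_sum) auto
      then show ?thesis using that by (simp add: abs_square_le_1)
    qed
    moreover have "?B = {f. \<forall>k. f k \<in> (if k < p then {-1..1} else {0})}"
      by (simp add: PiE_UNIV_domain Pi_def)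
    ultimately show ?thesis
      by (auto simp: fun_sphere_def abs_le_iff minus_le_iff not_less split: if_splits)
  qed
  ultimately show ?thesis
    by (simp add: compact_Int_closed)
qed

lemma fun_sphere_nonempty:
  assumes "p > 0"
  shows "fun_sphere p \<noteq> {}"
proof -
  let ?e = "\<lambda>k::nat. if k = 0 then 1 else 0 :: real"
  have "(\<Sum>k<p. (?e k)\<^sup>2) = (\<Sum>k<p. ?e k)"
    by (intro sum.cong) auto
  then have "?e \<in> fun_sphere p"
    using assms by (simp add: fun_sphere_def)
  then show ?thesis by blast
qed

lemma fun_sphere_nonzero:
  assumes "f \<in> fun_sphere p"
  shows "vec p f \<in> nonzero_vecs p"
proof -
  have "vec p f \<noteq> 0\<^sub>v p"
  proof
    assume eq: "vec p f = 0\<^sub>v p"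
    have "f k = 0" if "k < p" for k
      using arg_cong[OF eq, of "\<lambda>v. v $ k"] that by simp
    then show False using assms by (simp add: fun_sphere_def)
  qed
  then show ?thesis by (simp add: nonzero_vecs_def)
qed

lemma nonzero_vec_scaled_sphere:
  assumes v: "v \<in> nonzero_vecs p"
  obtains c f where "c > 0" "f \<in> fun_sphere p" "v = c \<cdot>\<^sub>v vec p f"
proof -
  let ?N = "\<Sum>k<p. (v $ k)\<^sup>2"
  have "?N \<noteq> 0"
  proof
    assume "?N = 0"
    then have "v = 0\<^sub>v p"
      using v by (intro eq_vecI) (auto simp: nonzero_vecs_def sum_nonneg_eq_0_iff)
    with v show False by (simp add: nonzero_vecs_def)
  qed
  then have N: "?N > 0"
    by (simp add: less_le sum_nonneg)
  show thesis
  proof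
    show "(\<lambda>k. if k < p then v $ k / sqrt ?N else 0) \<in> fun_sphere p"
      using N by (simp add: fun_sphere_def power_divide less_imp_le flip: sum_divide_distrib)
    show "v = sqrt ?N \<cdot>\<^sub>v vec p (\<lambda>k. if k < p then v $ k / sqrt ?N else 0)"
      using N v by (intro eq_vecI) (auto simp: nonzero_vecs_def)
  qed (use N in simp)
qed

text \<open>On the product of the spheres the denominator is positive, so the objective is a
  continuous quotient on a compact set; positive scaling carries its maximum over to all pairs of
  nonzero vectors.\<close>

lemma ex_cca_maximizer:
  assumes car: "Sx \<in> carrier_mat p p" "Sy \<in> carrier_mat q q" "Sxy \<in> carrier_mat p q"
    and pq: "p > 0" "q > 0"
    and pos: "\<And>v. v \<in> nonzero_vecs p \<Longrightarrow> quad_form Sx v > 0"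
      "\<And>v. v \<in> nonzero_vecs q \<Longrightarrow> quad_form Sy v > 0"
  shows "\<exists>a b. cca_maximizer Sx Sy Sxy a b"
proof -
  let ?S = "fun_sphere p \<times> fun_sphere q"
  define F where "F = (\<lambda>z. cca_objective Sx Sy Sxy (vec p (fst z)) (vec q (snd z)))"
  have F: "F z = (\<Sum>k<p. fst z k * (\<Sum>l<q. Sxy $$ (k, l) * snd z l)) /
      (sqrt (qform {..<p} Sx (fst z)) * sqrt (qform {..<q} Sy (snd z)))"
    and den: "qform {..<p} Sx (fst z) > 0" "qform {..<q} Sy (snd z) > 0" if "z \<in> ?S" for z
  proof -
    show den: "qform {..<p} Sx (fst z) > 0" "qform {..<q} Sy (snd z) > 0"
      using that car pos by (auto simp: fun_sphere_nonzero simp flip: quad_form_vec)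
    have "vec p (fst z) \<bullet> (Sxy *\<^sub>v vec q (snd z)) = (\<Sum>k<p. fst z k * (\<Sum>l<q. Sxy $$ (k, l) * snd z l))"
      using car by (simp add: scalar_prod_def atLeast0LessThan)
    then show "F z = (\<Sum>k<p. fst z k * (\<Sum>l<q. Sxy $$ (k, l) * snd z l)) /
      (sqrt (qform {..<p} Sx (fst z)) * sqrt (qform {..<q} Sy (snd z)))"
      using den car by (simp add: F_def cca_objective_def quad_form_vec)
  qed
  have coord: "continuous_on ?S (\<lambda>z. fst z k)" "continuous_on ?S (\<lambda>z. snd z k)" for k
    by (rule continuous_on_product_then_coordinatewise,
        (rule continuous_on_fst continuous_on_snd, rule continuous_on_id))+
  have "continuous_on ?S (\<lambda>z. (\<Sum>k<p. fst z k * (\<Sum>l<q. Sxy $$ (k, l) * snd z l)) /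
      (sqrt (qform {..<p} Sx (fst z)) * sqrt (qform {..<q} Sy (snd z))))"
    unfolding qform_def
    using den by (intro continuous_intros coord ballI) (force simp: qform_def)
  then have "continuous_on ?S F"
    by (subst continuous_on_cong[OF refl F])
  moreover have "compact ?S"
    by (intro compact_Times compact_fun_sphere)
  moreover have "?S \<noteq> {}"
    using fun_sphere_nonempty pq by simp
  ultimately obtain z where z: "z \<in> ?S" "\<And>y. y \<in> ?S \<Longrightarrow> F y \<le> F z"
    using continuous_attains_sup[of ?S F] by blast
  have "cca_maximizer Sx Sy Sxy (vec p (fst z)) (vec q (snd z))"
    unfolding cca_maximizer_def
  proof (intro conjI ballI)
    fix a b assume "a \<in> nonzero_vecs (dim_row Sx)" "b \<in> nonzero_vecs (dim_row Sy)"
    then have "a \<in> nonzero_vecs p" "b \<in> nonzero_vecs q"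
      using car by auto
    obtain c f where "c > 0" "f \<in> fun_sphere p" "a = c \<cdot>\<^sub>v vec p f"
      using nonzero_vec_scaled_sphere[OF \<open>a \<in> nonzero_vecs p\<close>] by blast
    moreover obtain d g where "d > 0" "g \<in> fun_sphere q" "b = d \<cdot>\<^sub>v vec q g"
      using nonzero_vec_scaled_sphere[OF \<open>b \<in> nonzero_vecs q\<close>] by blast
    ultimately show "cca_objective Sx Sy Sxy a b
        \<le> cca_objective Sx Sy Sxy (vec p (fst z)) (vec q (snd z))"
      using z(2)[of "(f, g)"] car by (simp add: F_def cca_objective_smult)
  qed (use z(1) car in \<open>auto simp: fun_sphere_nonzero\<close>)
  then show ?thesis by blast
qed

lemma canonical_corr_maximizer:
  assumes "cca_maximizer Sx Sy Sxy a b"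
  shows "canonical_corr Sx Sy Sxy = cca_objective Sx Sy Sxy a b"
  unfolding canonical_corr_def
  by (rule Greatest_equality) (use assms in \<open>auto simp: cca_maximizer_def\<close>)

text \<open>\<open>GREATEST\<close> is sure to be an upper bound only when the maximum is attained;
  positive definiteness enters through the existence of a maximizer.\<close>

lemma cca_objective_le_canonical_corr:
  assumes "Sx \<in> carrier_mat p p" "Sy \<in> carrier_mat q q" "Sxy \<in> carrier_mat p q"
    and ab: "a \<in> nonzero_vecs p" "b \<in> nonzero_vecs q"
    and "\<And>v. v \<in> nonzero_vecs p \<Longrightarrow> quad_form Sx v > 0"
      "\<And>v. v \<in> nonzero_vecs q \<Longrightarrow> quad_form Sy v > 0"
  shows "cca_objective Sx Sy Sxy a b \<le> canonical_corr Sx Sy Sxy"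
proof -
  \<comment> \<open>There is no nonzero vector of dimension 0.\<close>
  have "p > 0" "q > 0"
    using ab by (auto simp: nonzero_vecs_def intro!: Nat.gr0I)
  with ex_cca_maximizer[of Sx p Sy q Sxy] assms obtain a' b'
    where "cca_maximizer Sx Sy Sxy a' b'" by blast
  then show ?thesis
    using assms by (auto simp: canonical_corr_maximizer cca_maximizer_def)
qed

section \<open>Adding one index to the first block\<close>

text \<open>Normalizing only \<open>g\<close> suits the enlarged problem, where \<open>b\<close> is
  kept and the vector on the larger set is not normalized.\<close>

lemma cca_objective_restr:
  assumes "Sx \<in> carrier_mat n n" "Sy \<in> carrier_mat m m" "Sxy \<in> carrier_mat n m"
    and "I \<subseteq> {..<n}" "J \<subseteq> {..<m}"
    and "qform I Sx f \<noteq> 0" "qform J Sy g = 1"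
  shows "cca_objective (submatrix Sx I I) (submatrix Sy J J) (submatrix Sxy I J) (restr I f) (restr J g)
    = (\<Sum>i\<in>I. f i * (\<Sum>j\<in>J. Sxy $$ (i, j) * g j)) / sqrt (qform I Sx f)"
  using assms finite_subset[OF assms(4)]
  by (simp add: cca_objective_def quad_form_restr[of _ n] quad_form_restr[of _ m]
      submatrix_mult_restr[of _ n m] scalar_prod_restr)

text \<open>Semidefiniteness is required of \<open>Sx\<close> and \<open>Sy\<close> separately, so
  that the statement applies equally with the two blocks exchanged.\<close>

lemma canonical_corr_insert:
  assumes Sx: "Sx \<in> carrier_mat n n" and Sy: "Sy \<in> carrier_mat m m" and Sxy: "Sxy \<in> carrier_mat n m"
    and psd: "psd_on {..<n} Sx" "psd_on {..<m} Sy"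
    and I: "I \<subseteq> {..<n}" and J: "J \<subseteq> {..<m}"
    and max: "cca_maximizer (submatrix Sx I I) (submatrix Sy J J) (submatrix Sxy I J) a b"
    and norm: "quad_form (submatrix Sx I I) a = 1" "quad_form (submatrix Sy J J) b = 1"
    and i: "i < n" "i \<notin> I"
    and inv: "invertible_mat (submatrix Sx I I)" "invertible_mat (submatrix Sy J J)"
    and den: "schur_den Sx I i \<noteq> 0"
  shows "(canonical_corr (submatrix Sx I I) (submatrix Sy J J) (submatrix Sxy I J))\<^sup>2
            + delta Sx Sxy I J b i
      \<le> (canonical_corr (submatrix Sx (insert i I) (insert i I)) (submatrix Sy J J)
            (submatrix Sxy (insert i I) J))\<^sup>2"
proof -
  have fin: "finite I" "finite J"
    using I J finite_subset by auto
  have I': "insert i I \<subseteq> {..<n}"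
    using I i by simp
  have psd': "psd_on (insert i I) Sx"
    using psd(1) by (rule psd_on_subset) (use I' in auto)
  have sym: "Sx $$ (k, l) = Sx $$ (l, k)" if "k \<in> insert i I" "l \<in> insert i I" for k l
    using psd' that unfolding psd_on_def by blast
  have psdI: "psd_on I Sx"
    using psd' by (rule psd_on_subset) (use fin in auto)
  have psdJ: "psd_on J Sy"
    using psd(2) by (rule psd_on_subset) (use J in auto)
  have car_a: "a \<in> carrier_vec (card I)" and b_nz: "b \<in> nonzero_vecs (card J)"
    using max submatrix_carrier[OF Sx I I] submatrix_carrier[OF Sy J J]
    by (auto simp: cca_maximizer_def nonzero_vecs_def)
  obtain \<alpha> where \<alpha>: "a = restr I \<alpha>"
    using car_a by (rule restr_surj)
  obtain \<beta> where \<beta>: "b = restr J \<beta>"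
    using b_nz by (auto simp: nonzero_vecs_def elim: restr_surj)
  have norm_\<alpha>: "qform I Sx \<alpha> = 1" and norm_\<beta>: "qform J Sy \<beta> = 1"
    using norm I J by (simp_all add: \<alpha> \<beta> quad_form_restr[OF Sx] quad_form_restr[OF Sy])
  define c where "c k = (\<Sum>j\<in>J. Sxy $$ (k, j) * \<beta> j)" for k
  let ?\<rho> = "canonical_corr (submatrix Sx I I) (submatrix Sy J J) (submatrix Sxy I J)"
  let ?\<rho>' = "canonical_corr (submatrix Sx (insert i I) (insert i I)) (submatrix Sy J J)
    (submatrix Sxy (insert i I) J)"
  \<comment> \<open>Normalization of both vectors makes the denominator 1.\<close>
  have \<rho>: "?\<rho> = (\<Sum>k\<in>I. \<alpha> k * c k)"
    using cca_objective_restr[OF Sx Sy Sxy I J] norm_\<alpha> norm_\<beta>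
    by (simp add: canonical_corr_maximizer[OF max] \<alpha> \<beta> c_def)
  \<comment> \<open>\<open>u\<close> and \<open>w\<close> are the inverse of \<open>Sx\<close> on
    \<open>I\<close> applied to \<open>c\<close> and to column \<open>i\<close>,
    respectively.\<close>
  obtain u where u: "\<And>k. k \<in> I \<Longrightarrow> (\<Sum>l\<in>I. Sx $$ (k, l) * u l) = c k"
    using minv_restr[OF Sx I inv(1), of c] by blast
  obtain w where minv_w: "minv (submatrix Sx I I) *\<^sub>v restr I (\<lambda>k. Sx $$ (k, i)) = restr I w"
    and w: "\<And>k. k \<in> I \<Longrightarrow> (\<Sum>l\<in>I. Sx $$ (k, l) * w l) = Sx $$ (k, i)"
    using minv_restr[OF Sx I inv(1), of "\<lambda>k. Sx $$ (k, i)"] by blast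
  define s where "s = Sx $$ (i, i) - (\<Sum>k\<in>I. Sx $$ (k, i) * w k)"
  have schur: "schur_den Sx I i = s"
    using fin by (simp add: schur_den_def subcol_restr[OF Sx I i(1)] minv_w scalar_prod_restr s_def)
  \<comment> \<open>Up to sign, \<open>t\<close> is the number squared in
    \<open>delta\<close>.\<close>
  define t where "t = c i - (\<Sum>k\<in>I. w k * c k)"
  have delta: "delta Sx Sxy I J b i = t\<^sup>2 / s"
  proof -
    have "(submatrix Sxy I J)\<^sup>T *\<^sub>v restr I w = restr J (\<lambda>j. \<Sum>k\<in>I. Sxy\<^sup>T $$ (j, k) * w k)"
      using submatrix_mult_restr[of "Sxy\<^sup>T" m n J I w] I J Sxy by (simp add: submatrix_transpose)
    moreover have "(\<Sum>j\<in>J. \<beta> j * (\<Sum>k\<in>I. Sxy\<^sup>T $$ (j, k) * w k)) = (\<Sum>k\<in>I. w k * c k)"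
      unfolding c_def sum_distrib_left using I J Sxy
      by (subst sum.swap, intro sum.cong refl) (auto simp: subset_iff)
    moreover have "(\<Sum>j\<in>J. \<beta> j * Sxy $$ (i, j)) = c i"
      by (simp add: c_def mult.commute)
    ultimately show ?thesis
      using fin by (simp add: delta_def schur subcol_restr[OF Sx I i(1)] minv_w \<beta>
          subrow_restr[OF Sxy i(1) J] scalar_prod_restr t_def power2_commute)
  qed
  have s: "s \<noteq> 0"
    using den schur by simp
  have pdI: "pd_on I Sx"
    using Sx I psdI inv(1) by (rule pd_on_invertible)
  have pdI': "pd_on (insert i I) Sx"
    using psd' fin(1) i(2) pdI w s unfolding s_def by (rule pd_on_insert)
  have pdJ: "pd_on J Sy"
    using Sy J psdJ inv(2) by (rule pd_on_invertible)
  define U where "U = (\<Sum>k\<in>I. u k * c k)"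
  \<comment> \<open>Cauchy-Schwarz for the inner product given by \<open>Sx\<close> on
    \<open>I\<close>: the form at \<rho> \<alpha> - u is nonnegative and expands to \<rho>^2 - 2
    \<rho>^2 + U.\<close>
  have \<rho>_le: "?\<rho>\<^sup>2 \<le> U"
  proof -
    have qu: "qform I Sx u = U"
      by (simp add: qform_def u U_def)
    have "0 \<le> qform I Sx (\<lambda>k. \<alpha> k * ?\<rho> + - 1 * u k)"
      using psdI by (simp add: psd_on_def)
    also have "\<dots> = qform I Sx (\<lambda>k. \<alpha> k * ?\<rho>) - 2 * (\<Sum>k\<in>I. \<alpha> k * ?\<rho> * (\<Sum>l\<in>I. Sx $$ (k, l) * u l)) + U"
      by (subst qform_add) (use sym in \<open>auto simp: qu\<close>)
    also have "(\<Sum>k\<in>I. \<alpha> k * ?\<rho> * (\<Sum>l\<in>I. Sx $$ (k, l) * u l)) = ?\<rho> * (\<Sum>k\<in>I. \<alpha> k * c k)"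
      unfolding sum_distrib_left[of ?\<rho>] by (intro sum.cong) (simp_all add: u)
    also have "\<dots> = ?\<rho>\<^sup>2"
      by (simp add: \<rho> power2_eq_square)
    also have "qform I Sx (\<lambda>k. \<alpha> k * ?\<rho>) = ?\<rho>\<^sup>2 * qform I Sx \<alpha>"
      by (simp add: qform_def sum_distrib_left power2_eq_square mult_ac)
    finally show ?thesis
      by (simp add: norm_\<alpha>)
  qed
  \<comment> \<open>Row \<open>i\<close> of the system for the enlarged block reduces to
    \<open>c i - t + \<tau> * s = c i\<close>, which determines this value.\<close>
  define \<tau> where "\<tau> = t / s"
  \<comment> \<open>The coordinates of the inverse of \<open>Sx\<close> on \<open>insert i I\<close> applied to \<open>c\<close>,
    by block elimination.\<close>
  define \<phi> where "\<phi> k = (if k = i then \<tau> else u k - \<tau> * w k)" for k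
  \<comment> \<open>\<open>N\<close> turns out to be both the numerator and the quadratic form at
    \<phi>, so for positive \<open>N\<close> the objective there is N / sqrt N = sqrt N.\<close>
  define N where "N = U + t\<^sup>2 / s"
  \<comment> \<open>The free \<open>h\<close> serves both for \<open>c\<close> in the numerator and
    for the rows of \<open>Sx\<close> in the system.\<close>
  have sum_\<phi>: "(\<Sum>k\<in>insert i I. h k * \<phi> k)
      = (\<Sum>k\<in>I. h k * u k) - \<tau> * (\<Sum>k\<in>I. h k * w k) + \<tau> * h i" for h
  proof -
    have "(\<Sum>k\<in>I. h k * \<phi> k) = (\<Sum>k\<in>I. h k * u k - \<tau> * (h k * w k))"
      using i by (intro sum.cong) (auto simp: \<phi>_def algebra_simps)
    then show ?thesis
      using fin i by (simp add: \<phi>_def sum_subtractf flip: sum_distrib_left)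
  qed
  have numerator: "(\<Sum>k\<in>insert i I. \<phi> k * c k) = N"
  proof -
    have "(\<Sum>k\<in>insert i I. \<phi> k * c k) = (\<Sum>k\<in>insert i I. c k * \<phi> k)"
      by (intro sum.cong refl mult.commute)
    also have "\<dots> = (\<Sum>k\<in>I. u k * c k) - \<tau> * (\<Sum>k\<in>I. w k * c k) + \<tau> * c i"
      unfolding sum_\<phi> by (simp only: mult.commute[of "c _"])
    also have "\<dots> = U + \<tau> * t"
      by (simp add: U_def t_def right_diff_distrib)
    finally show ?thesis
      by (simp add: N_def \<tau>_def power2_eq_square)
  qed
  \<comment> \<open>\<phi> solves the enlarged system: in rows from \<open>I\<close> the terms with
    \<open>w\<close> and with column \<open>i\<close> cancel, and row \<open>i\<close> is where
    \<tau> is used.\<close>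
  have "(\<Sum>l\<in>insert i I. Sx $$ (k, l) * \<phi> l) = c k" if "k \<in> insert i I" for k
  proof (cases "k = i")
    case True
    have row: "(\<Sum>l\<in>I. Sx $$ (i, l) * v l) = (\<Sum>l\<in>I. Sx $$ (l, i) * v l)" for v
      by (intro sum.cong) (simp_all add: sym)
    \<comment> \<open>By symmetry and the equations for \<open>w\<close> and \<open>u\<close>,
      pairing column \<open>i\<close> with \<open>u\<close> amounts to pairing \<open>w\<close> with
      \<open>c\<close>.\<close>
    have "(\<Sum>l\<in>I. Sx $$ (l, i) * u l) = (\<Sum>l\<in>I. \<Sum>k\<in>I. Sx $$ (l, k) * w k * u l)"
      by (simp add: w flip: sum_distrib_right)
    also have "\<dots> = (\<Sum>k\<in>I. w k * (\<Sum>l\<in>I. Sx $$ (k, l) * u l))"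
      unfolding sum_distrib_left
      by (subst sum.swap, intro sum.cong refl) (simp add: sym)
    also have "\<dots> = c i - t"
      by (simp add: u t_def)
    finally have "(\<Sum>l\<in>insert i I. Sx $$ (i, l) * \<phi> l)
        = c i - t + \<tau> * (Sx $$ (i, i) - (\<Sum>l\<in>I. Sx $$ (l, i) * w l))"
      by (simp only: sum_\<phi> row) (simp add: algebra_simps)
    then show ?thesis
      using s True by (simp add: \<tau>_def flip: s_def)
  next
    case False
    then show ?thesis
      using that by (simp add: sum_\<phi> u w)
  qed
  then have quad: "qform (insert i I) Sx \<phi> = N"
    by (simp add: qform_def flip: numerator)
  have "?\<rho>\<^sup>2 + delta Sx Sxy I J b i \<le> N"
    using \<rho>_le by (simp add: delta N_def)
  \<comment> \<open>For \<open>N = 0\<close> the bound is just nonnegativity of a square; \<phi>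
    then vanishes on \<open>insert i I\<close> and is not admissible in the objective.\<close>
  also have "N \<le> ?\<rho>'\<^sup>2"
  proof (cases "N = 0")
    case False
    have "N \<ge> 0"
      using psd' unfolding quad[symmetric] psd_on_def by blast
    with False have pos: "N > 0"
      by simp
    have "restr (insert i I) \<phi> \<noteq> 0\<^sub>v (card (insert i I))"
    proof
      assume "restr (insert i I) \<phi> = 0\<^sub>v (card (insert i I))"
      also have "\<dots> = restr (insert i I) (\<lambda>_. 0)"
        by (auto simp: restr_def)
      finally have "\<forall>k\<in>insert i I. \<phi> k = 0"
        using fin by (simp add: restr_eq_iff)
      then have "(\<Sum>k\<in>insert i I. \<phi> k * c k) = 0"
        by (intro sum.neutral) auto
      then show False
        using False numerator by simp
    qed
    then have nz: "restr (insert i I) \<phi> \<in> nonzero_vecs (card (insert i I))"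
      by (simp add: nonzero_vecs_def)
    have "sqrt N = N / sqrt N"
      using pos by (simp add: real_div_sqrt)
    also have "\<dots> = cca_objective (submatrix Sx (insert i I) (insert i I)) (submatrix Sy J J)
        (submatrix Sxy (insert i I) J) (restr (insert i I) \<phi>) b"
      using cca_objective_restr[OF Sx Sy Sxy I' J, of \<phi> \<beta>] False norm_\<beta>
      by (simp only: quad numerator[unfolded c_def] \<beta>) simp
    also have "\<dots> \<le> ?\<rho>'"
      using submatrix_carrier[OF Sx I' I'] submatrix_carrier[OF Sy J J]
        submatrix_carrier[OF Sxy I' J] nz b_nz
        pd_on_quad_form_pos[OF Sx I' pdI'] pd_on_quad_form_pos[OF Sy J pdJ]
      by (rule cca_objective_le_canonical_corr)
    finally have "(sqrt N)\<^sup>2 \<le> ?\<rho>'\<^sup>2"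
      using pos by (intro power_mono) auto
    then show ?thesis
      using pos by simp
  qed simp
  finally show ?thesis .
qed

section \<open>Exchanging the two blocks\<close>

lemma cca_objective_transpose:
  assumes "Sx \<in> carrier_mat p p" "Sy \<in> carrier_mat q q" "Sxy \<in> carrier_mat p q"
    and "a \<in> carrier_vec p" "b \<in> carrier_vec q"
  shows "cca_objective Sy Sx Sxy\<^sup>T b a = cca_objective Sx Sy Sxy a b"
proof -
  have "b \<bullet> (Sxy\<^sup>T *\<^sub>v a) = a \<bullet> (Sxy *\<^sub>v b)"
    using assms by (metis transpose_vec_mult_scalar comm_scalar_prod mult_mat_vec_carrier transpose_carrier_mat)
  then show ?thesis
    by (simp add: cca_objective_def mult.commute)
qed

lemma canonical_corr_transpose:
  assumes "Sx \<in> carrier_mat p p" "Sy \<in> carrier_mat q q" "Sxy \<in> carrier_mat p q"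
  shows "canonical_corr Sy Sx Sxy\<^sup>T = canonical_corr Sx Sy Sxy"
proof -
  have "(\<exists>b\<in>nonzero_vecs q. \<exists>a\<in>nonzero_vecs p. r = cca_objective Sy Sx Sxy\<^sup>T b a)
    \<longleftrightarrow> (\<exists>a\<in>nonzero_vecs p. \<exists>b\<in>nonzero_vecs q. r = cca_objective Sx Sy Sxy a b)" for r
    using cca_objective_transpose[OF assms] unfolding nonzero_vecs_def by (metis DiffD1)
  then show ?thesis
    using assms by (simp add: canonical_corr_def)
qed

lemma cca_maximizer_transpose:
  assumes "Sx \<in> carrier_mat p p" "Sy \<in> carrier_mat q q" "Sxy \<in> carrier_mat p q"
    and "cca_maximizer Sx Sy Sxy a b"
  shows "cca_maximizer Sy Sx Sxy\<^sup>T b a"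
  using assms cca_objective_transpose[OF assms(1-3)]
  by (auto simp: cca_maximizer_def nonzero_vecs_def)

text \<open>Row \<open>j\<close> of the transpose is column \<open>j\<close> of \<open>Sxy\<close>,
  so the second gain is the first one for the exchanged problem.\<close>

lemma gamma_eq_delta_transpose:
  assumes "Sy \<in> carrier_mat m m" "Sxy \<in> carrier_mat n m" "I \<subseteq> {..<n}" "J \<subseteq> {..<m}" "j < m"
  shows "gamma Sy Sxy I J a j = delta Sy Sxy\<^sup>T J I a j"
proof -
  have "subrow Sxy\<^sup>T j I = subcol Sxy I j"
    using assms
    by (auto simp: subrow_restr[of _ m n] subcol_restr[of _ n m] subset_iff intro!: restr_cong)
  then show ?thesis
    using assms by (simp add: gamma_def delta_def submatrix_transpose)
qed

section \<open>Diagonal blocks of the joint matrix, and the conclusion\<close>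

text \<open>Both diagonal blocks are principal submatrices of the joint matrix, the second one on
  indices shifted by \<open>n\<close>.\<close>

lemma psd_on_blocks:
  assumes Sx: "Sx \<in> carrier_mat n n" and Sy: "Sy \<in> carrier_mat m m"
    and psd: "psd_mat (four_block_mat Sx Sxy Sxy\<^sup>T Sy)"
  shows "psd_on {..<n} Sx" "psd_on {..<m} Sy"
proof -
  let ?S = "four_block_mat Sx Sxy Sxy\<^sup>T Sy"
  have joint: "psd_on {..<n + m} ?S"
    using psd Sx Sy by (intro psd_mat_psd_on) auto
  have "psd_on {..<n} ?S"
    by (rule psd_on_subset[OF joint]) auto
  then show "psd_on {..<n} Sx"
    using Sx Sy by (simp add: psd_on_def qform_def)
  have lower: "psd_on {n..<n + m} ?S"
    by (rule psd_on_subset[OF joint]) auto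
  have entry: "?S $$ (k + n, l + n) = Sy $$ (k, l)" if "k < m" "l < m" for k l
    using Sx Sy that by simp
  have shift: "sum h {n..<n + m} = (\<Sum>k<m. h (k + n))" for h :: "nat \<Rightarrow> real"
    using sum.shift_bounds_nat_ivl[of h 0 n m] by (simp add: add.commute atLeast0LessThan)
  show "psd_on {..<m} Sy"
    unfolding psd_on_def
  proof (intro conjI ballI allI)
    fix k l assume "k \<in> {..<m}" "l \<in> {..<m}"
    then show "Sy $$ (k, l) = Sy $$ (l, k)"
      using lower by (simp add: psd_on_def flip: entry)
  next
    fix f
    \<comment> \<open>The shift makes the test function take the value \<open>f k\<close> at
      \<open>k + n\<close>.\<close>
    have "0 \<le> qform {n..<n + m} ?S (\<lambda>k. f (k - n))"
      using lower by (simp add: psd_on_def)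
    also have "\<dots> = qform {..<m} Sy f"
      unfolding qform_def shift by (intro sum.cong refl) (simp add: entry del: index_mat_four_block)
    finally show "0 \<le> qform {..<m} Sy f" .
  qed
qed

theorem lemma1:
  fixes n m :: nat
    and Sx Sy Sxy :: "real mat"
    and I J :: "nat set"
    and a b :: "real vec"
    and i j :: nat
  assumes "n \<ge> 1" and "m \<ge> 1"
    and "Sx \<in> carrier_mat n n" and "Sy \<in> carrier_mat m m" and "Sxy \<in> carrier_mat n m"
    and "psd_mat (four_block_mat Sx Sxy (Sxy\<^sup>T) Sy)"
    and "I \<subseteq> {..<n}" and "I \<noteq> {}"
    and "J \<subseteq> {..<m}" and "J \<noteq> {}"
    and "cca_maximizer (submatrix Sx I I) (submatrix Sy J J) (submatrix Sxy I J) a b"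
    and "quad_form (submatrix Sx I I) a = 1"
    and "quad_form (submatrix Sy J J) b = 1"
    and "i \<in> {..<n} - I" and "j \<in> {..<m} - J"
    and "invertible_mat (submatrix Sx I I)" and "invertible_mat (submatrix Sy J J)"
    and "schur_den Sx I i \<noteq> 0" and "schur_den Sy J j \<noteq> 0"
  shows "(canonical_corr (submatrix Sx (insert i I) (insert i I)) (submatrix Sy J J)
            (submatrix Sxy (insert i I) J))\<^sup>2
         \<ge> (canonical_corr (submatrix Sx I I) (submatrix Sy J J) (submatrix Sxy I J))\<^sup>2
            + delta Sx Sxy I J b i
       \<and> (canonical_corr (submatrix Sx I I) (submatrix Sy (insert j J) (insert j J))
            (submatrix Sxy I (insert j J)))\<^sup>2
         \<ge> (canonical_corr (submatrix Sx I I) (submatrix Sy J J) (submatrix Sxy I J))\<^sup>2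
            + gamma Sy Sxy I J a j"
proof
  note psd = psd_on_blocks[OF assms(3,4,6)]
  have i: "i < n" "i \<notin> I" and j: "j < m" "j \<notin> J"
    using assms(14,15) by auto
  show "(canonical_corr (submatrix Sx (insert i I) (insert i I)) (submatrix Sy J J)
            (submatrix Sxy (insert i I) J))\<^sup>2
         \<ge> (canonical_corr (submatrix Sx I I) (submatrix Sy J J) (submatrix Sxy I J))\<^sup>2
            + delta Sx Sxy I J b i"
    using assms(3-5) psd assms(7,9,11-13) i assms(16-18) by (rule canonical_corr_insert)
  \<comment> \<open>For the second inequality, the first is applied with the blocks exchanged and
    \<open>b\<close>, \<open>a\<close> as maximizing pair; the transposition lemmas translate the
    result back.\<close>
  have J': "insert j J \<subseteq> {..<m}"
    using assms(9) j by simp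
  note blocks = submatrix_carrier[OF assms(3,7,7)] submatrix_carrier[OF assms(4,9,9)]
    submatrix_carrier[OF assms(5,7,9)]
  note blocks' = submatrix_carrier[OF assms(3,7,7)] submatrix_carrier[OF assms(4) J' J']
    submatrix_carrier[OF assms(5,7) J']
  have Sxy': "Sxy\<^sup>T \<in> carrier_mat m n"
    using assms(5) by simp
  note T = submatrix_transpose[OF assms(5,7,9)] and T' = submatrix_transpose[OF assms(5,7) J']
  have max: "cca_maximizer (submatrix Sy J J) (submatrix Sx I I) (submatrix Sxy\<^sup>T J I) b a"
    unfolding T using blocks assms(11) by (rule cca_maximizer_transpose)
  show "(canonical_corr (submatrix Sx I I) (submatrix Sy (insert j J) (insert j J))
            (submatrix Sxy I (insert j J)))\<^sup>2
         \<ge> (canonical_corr (submatrix Sx I I) (submatrix Sy J J) (submatrix Sxy I J))\<^sup>2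
            + gamma Sy Sxy I J a j"
    using canonical_corr_insert[OF assms(4,3) Sxy' psd(2,1) assms(9,7) max assms(13,12) j
        assms(17,16,19)]
    unfolding T T' canonical_corr_transpose[OF blocks] canonical_corr_transpose[OF blocks']
      gamma_eq_delta_transpose[OF assms(4,5,7,9) j(1)] .
qed

end
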